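(* BFECC interpolation (based on linear interpolation in 1D and on bilinear interpolation in 2D) from a uniform rectangular grid in 1D (mesh size $\Delta x$) or 2D (mesh sizes $\Delta x$ and $\Delta y$, not necessarily equal) to the grid obtained by shifting it along any vector is 3rd order accurate; and if the shifted grid points are located at the centroids of the original grid cells, it is 4th order accurate. That is: (1D) For every sufficiently smooth $f:\mathbb{R}\to\mathbb{R}$ there is a constant $C$ (depending only on $f$) such that for every $0<\Delta x\le 1$ and every $w\in\mathbb{R}$, with $\mathcal{G}_1=\{i\Delta x: i\in\mathbb{Z}\}$ and $\mathcal{G}_2=\mathcal{G}_1+w$, the BFECC-interpolated values $f^{new}_{p}$ of $f$ from $\mathcal{G}_1$ to $\mathcal{G}_2$ satisfy $|f^{new}_{p}-f(p)|\le C\Delta x^3$ for all $p\in\mathcal{G}_2$; and if in addition $w/\Delta x\in\frac12+\mathbb{Z}$, then $|f^{new}_{p}-f(p)|\le C\Delta x^4$ for all $p\in\mathcal{G}_2$. (2D) For every sufficiently smooth $f:\mathbb{R}^2\to\mathbb{R}$ there is a constant $C$ (depending only on $f$) such that for all $0<\Delta x,\Delta y\le 1$ and every $\mathbf{w}=(w_1,w_2)\in\mathbb{R}^2$, with $\mathcal{G}_1=\{(i\Delta x,j\Delta y): i,j\in\mathbb{Z}\}$ and $\mathcal{G}_2=\mathcal{G}_1+\mathbf{w}$, the BFECC-interpolated values $f^{new}_{\mathbf{p}}$ of $f$ from $\mathcal{G}_1$ to $\mathcal{G}_2$ satisfy $|f^{new}_{\mathbf{p}}-f(\mathbf{p})|\le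 C(\Delta x^3+\Delta y^3)$ for all $\mathbf{p}\in\mathcal{G}_2$; and if in addition $w_1/\Delta x\in\frac12+\mathbb{Z}$ and $w_2/\Delta y\in\frac12+\mathbb{Z}$, then $|f^{new}_{\mathbf{p}}-f(\mathbf{p})|\le C(\Delta x^4+\Delta y^4)$ for all $\mathbf{p}\in\mathcal{G}_2$.
   Context: Local linear interpolation on a rectangular grid: given values at the grid points of an (infinite) uniform rectangular grid in $\mathbb{R}$ or $\mathbb{R}^2$, the value at a point $\mathbf{p}$ is that of the linear (1D) or bilinear (2D) interpolant of the values at the vertices of a closed grid cell containing $\mathbf{p}$; it does not depend on the choice of cell when $\mathbf{p}$ lies in several. BFECC interpolation of a function $f$ from a grid $\mathcal{G}_1$ to a grid $\mathcal{G}_2$ (both infinite uniform rectangular grids, $\mathcal{G}_2$ a translate of $\mathcal{G}_1$): write $f_{\mathbf{i}}$ for the value of $f$ at the grid point $\mathbf{i}\in\mathcal{G}_1$. 1. Forward interpolation: use local linear interpolation to interpolate the values $\{f_{\mathbf{i}}\}$ from the grid points of $\mathcal{G}_1$ to every grid point of $\mathcal{G}_2$, obtaining values $f^*$ on $\mathcal{G}_2$. 2. Backward interpolation: use local linear interpolation to interpolate the values $f^*$ from the grid points of $\mathcal{G}_2$ to every grid point $\mathbf{i}$ of $\mathcal{G}_1$, obtaining $\tilde f_{\mathbf{i}}$. 3. Error compensation: set $\hat f_{\mathbf{i}}=f_{\mathbf{i}}+\frac12(f_{\mathbf{i}}-\tilde f_{\mathbf{i}})$ for every $\mathbf{i}\in\mathcal{G}_1$.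 4. Forward interpolation: use local linear interpolation to interpolate the values $\{\hat f_{\mathbf{i}}\}$ from the grid points of $\mathcal{G}_1$ to every grid point $\mathbf{p}$ of $\mathcal{G}_2$; the result is $f^{new}_{\mathbf{p}}$. "Sufficiently smooth" may be read as: $C^\infty$ with all (partial) derivatives bounded. The shifted grid points are the centroids of the original grid cells exactly when each component of the shift divided by the corresponding mesh size lies in $\frac12+\mathbb{Z}$. *)

theory Defs
  imports "HOL-Analysis.Analysis"
begin

section \<open>Uniform grids and local linear interpolation\<close>

definition grid1 :: "real \<Rightarrow> real \<Rightarrow> real set" where
  "grid1 a h = range (\<lambda>i::int. a + of_int i * h)"

definition grid2 :: "real \<times> real \<Rightarrow> real \<times> real \<Rightarrow> (real \<times> real) set" where
  "grid2 a h = grid1 (fst a) (fst h) \<times> grid1 (snd a) (snd h)"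

text \<open>
  Grid values are given by a total function \<open>v\<close> on points, of which only the values at grid
  points are ever used (see the congruence lemmas below).  The interpolants of a single cell
  take the index of that cell's lower (left) corner.
\<close>

definition lin_cell :: "real \<Rightarrow> real \<Rightarrow> int \<Rightarrow> (real \<Rightarrow> real) \<Rightarrow> real \<Rightarrow> real" where
  "lin_cell a h i v x =
    (let x0 = a + of_int i * h; x1 = a + of_int (i + 1) * h; s = (x - x0) / h
     in (1 - s) * v x0 + s * v x1)"

definition bilin_cell ::
  "real \<times> real \<Rightarrow> real \<times> real \<Rightarrow> int \<Rightarrow> int \<Rightarrow> (real \<times> real \<Rightarrow> real) \<Rightarrow> real \<times> real \<Rightarrow> real" where
  "bilin_cell a h i j v p =
    (let x0 = fst a + of_int i * fst h; x1 = fst a + of_int (i + 1) * fst h;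
         y0 = snd a + of_int j * snd h; y1 = snd a + of_int (j + 1) * snd h;
         s = (fst p - x0) / fst h; t = (snd p - y0) / snd h
     in (1 - s) * (1 - t) * v (x0, y0) + s * (1 - t) * v (x1, y0)
        + (1 - s) * t * v (x0, y1) + s * t * v (x1, y1))"

text \<open>
  Among the closed cells containing a point the lower one is selected; the choice is immaterial
  by the lemmas \<open>lin_interp_eq_cell\<close> and \<open>bilin_interp_eq_cell\<close>.
\<close>

definition lin_interp :: "real \<Rightarrow> real \<Rightarrow> (real \<Rightarrow> real) \<Rightarrow> real \<Rightarrow> real" where
  "lin_interp a h v x = lin_cell a h \<lfloor>(x - a) / h\<rfloor> v x"

definition bilin_interp ::
  "real \<times> real \<Rightarrow> real \<times> real \<Rightarrow> (real \<times> real \<Rightarrow> real) \<Rightarrow> real \<times> real \<Rightarrow> real" where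
  "bilin_interp a h v p =
    bilin_cell a h \<lfloor>(fst p - fst a) / fst h\<rfloor> \<lfloor>(snd p - snd a) / snd h\<rfloor> v p"

lemma cell_index_cases:
  fixes a h x :: real
  assumes "h > 0" "x \<in> {a + of_int i * h .. a + of_int (i + 1) * h}"
  obtains "\<lfloor>(x - a) / h\<rfloor> = i" | "\<lfloor>(x - a) / h\<rfloor> = i + 1" "x = a + of_int (i + 1) * h"
proof (cases "x = a + of_int (i + 1) * h")
  case True
  then have "(x - a) / h = of_int (i + 1)" using assms(1) by simp
  then show ?thesis using True that(2) by (metis floor_of_int)
next
  case False
  then have "x < a + of_int (i + 1) * h" using assms(2) by simp
  then have "of_int i \<le> (x - a) / h \<and> (x - a) / h < of_int i + 1"
    using assms by (auto simp: field_simps)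
  then show ?thesis using that(1) by (simp add: floor_unique)
qed

lemma lin_interp_eq_cell:
  assumes "h > 0" "x \<in> {a + of_int i * h .. a + of_int (i + 1) * h}"
  shows "lin_interp a h v x = lin_cell a h i v x"
  using assms
proof (cases rule: cell_index_cases)
  case 1
  then show ?thesis by (simp add: lin_interp_def)
next
  case 2
  have "(a + of_int (i + 1) * h - (a + of_int i * h)) / h = 1"
    using assms(1) by (simp add: field_simps)
  then show ?thesis by (simp add: lin_interp_def 2 lin_cell_def Let_def del: of_int_add)
qed

lemma bilin_cell_eq_lin_cell:
  "bilin_cell a h i j v (x, y) =
    lin_cell (fst a) (fst h) i (\<lambda>x'. lin_cell (snd a) (snd h) j (\<lambda>y'. v (x', y')) y) x"
  unfolding bilin_cell_def lin_cell_def Let_def fst_conv snd_conv by algebra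

lemma bilin_interp_eq_lin_interp:
  "bilin_interp a h v (x, y) =
    lin_interp (fst a) (fst h) (\<lambda>x'. lin_interp (snd a) (snd h) (\<lambda>y'. v (x', y')) y) x"
  by (simp add: bilin_interp_def lin_interp_def bilin_cell_eq_lin_cell)

lemma bilin_interp_eq_cell:
  assumes "fst h > 0" "snd h > 0"
    and "fst p \<in> {fst a + of_int i * fst h .. fst a + of_int (i + 1) * fst h}"
    and "snd p \<in> {snd a + of_int j * snd h .. snd a + of_int (j + 1) * snd h}"
  shows "bilin_interp a h v p = bilin_cell a h i j v p"
proof -
  obtain x y where p: "p = (x, y)" by (cases p)
  show ?thesis
    using assms
    by (simp add: p bilin_interp_eq_lin_interp bilin_cell_eq_lin_cell lin_interp_eq_cell)
qed

lemma lin_interp_cong: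
  assumes "\<And>q. q \<in> grid1 a h \<Longrightarrow> v q = v' q"
  shows "lin_interp a h v x = lin_interp a h v' x"
proof -
  have "v (a + of_int i * h) = v' (a + of_int i * h)" for i :: int
    by (rule assms) (auto simp: grid1_def)
  then show ?thesis
    unfolding lin_interp_def lin_cell_def Let_def by presburger
qed

lemma bilin_interp_cong:
  assumes "\<And>q. q \<in> grid2 a h \<Longrightarrow> v q = v' q"
  shows "bilin_interp a h v p = bilin_interp a h v' p"
proof -
  have "v (fst a + of_int i * fst h, snd a + of_int j * snd h) =
        v' (fst a + of_int i * fst h, snd a + of_int j * snd h)" for i j :: int
    by (rule assms) (auto simp: grid2_def grid1_def)
  then show ?thesis
    unfolding bilin_interp_def bilin_cell_def Let_def by presburger
qed


section \<open>BFECC interpolation\<close>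

text \<open>
  \<open>F\<close> interpolates from the first grid to the second, \<open>B\<close> from the second to the first.
\<close>

definition bfecc ::
  "(('a \<Rightarrow> real) \<Rightarrow> 'a \<Rightarrow> real) \<Rightarrow> (('a \<Rightarrow> real) \<Rightarrow> 'a \<Rightarrow> real) \<Rightarrow> ('a \<Rightarrow> real) \<Rightarrow> 'a \<Rightarrow> real" where
  "bfecc F B f =
    (let f_star = F f;
         f_tilde = B f_star;
         f_hat = (\<lambda>i. f i + 1/2 * (f i - f_tilde i))
     in F f_hat)"

definition bfecc1 :: "real \<Rightarrow> real \<Rightarrow> (real \<Rightarrow> real) \<Rightarrow> real \<Rightarrow> real" where
  "bfecc1 h w = bfecc (lin_interp 0 h) (lin_interp w h)"

definition bfecc2 ::
  "real \<times> real \<Rightarrow> real \<times> real \<Rightarrow> (real \<times> real \<Rightarrow> real) \<Rightarrow> real \<times> real \<Rightarrow> real" where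
  "bfecc2 h w = bfecc (bilin_interp (0, 0) h) (bilin_interp w h)"


section \<open>Smooth functions with bounded derivatives\<close>

text \<open>
  Boundedness is required of the derivatives of order at least one only, not of the function
  itself.
\<close>

definition smooth1 :: "(real \<Rightarrow> real) \<Rightarrow> bool" where
  "smooth1 f \<longleftrightarrow>
    (\<forall>n x. (deriv ^^ n) f field_differentiable at x) \<and>
    (\<forall>n\<ge>1. bounded (range ((deriv ^^ n) f)))"

definition partial_x :: "(real \<times> real \<Rightarrow> real) \<Rightarrow> real \<times> real \<Rightarrow> real" where
  "partial_x f p = deriv (\<lambda>x. f (x, snd p)) (fst p)"

definition partial_y :: "(real \<times> real \<Rightarrow> real) \<Rightarrow> real \<times> real \<Rightarrow> real" where
  "partial_y f p = deriv (\<lambda>y. f (fst p, y)) (snd p)"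

text \<open>The iterated partial derivatives of all orders, in any sequence, including \<open>f\<close> itself.\<close>

inductive_set partials :: "(real \<times> real \<Rightarrow> real) \<Rightarrow> (real \<times> real \<Rightarrow> real) set"
  for f :: "real \<times> real \<Rightarrow> real" where
  self: "f \<in> partials f"
| px: "g \<in> partials f \<Longrightarrow> partial_x g \<in> partials f"
| py: "g \<in> partials f \<Longrightarrow> partial_y g \<in> partials f"

definition smooth2 :: "(real \<times> real \<Rightarrow> real) \<Rightarrow> bool" where
  "smooth2 f \<longleftrightarrow>
    (\<forall>g\<in>partials f.
      continuous_on UNIV g \<and>
      (\<forall>x y. (\<lambda>t. g (t, y)) field_differentiable at x \<and>
             (\<lambda>t. g (x, t)) field_differentiable at y) \<and>
      bounded (range (partial_x g)) \<and> bounded (range (partial_y g)))"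

end

theory Submission
  imports Defs
begin

text \<open>
  On the points of the two grids, interpolation is a translation-invariant operator.  In one
  dimension, with \<open>s\<close> the fractional part of \<open>w / h\<close>, forward interpolation \<open>F\<close> is the average of the
  values at \<open>p - s h\<close> and \<open>p + (1 - s) h\<close> with weights \<open>1 - s\<close> and \<open>s\<close> (\<open>lin_interp_forward\<close>), and
  backward interpolation \<open>B\<close> is its mirror image (\<open>lin_interp_backward\<close>).  The round trip is therefore
  symmetric: \<open>B F = 1 + s (1 - s) \<delta>\<^sup>2\<close> with \<open>\<delta>\<^sup>2\<close> the second central difference
  (\<open>two_point_back_forth\<close>).  BFECC is thus the operator \<open>F (1 - s (1 - s) \<delta>\<^sup>2 / 2)\<close>, and its correction
  term cancels exactly the leading error \<open>s (1 - s) h\<^sup>2 f'' / 2\<close> of linear interpolation.  What remains,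
  the defect \<open>E = F (1 - s (1 - s) \<delta>\<^sup>2 / 2) - 1\<close>, is a five-point stencil whose moments of order 0, 1
  and 2 vanish; the third moment is \<open>s (1 - s) (1 - 2 s)\<close>, which vanishes too in the centroid case
  \<open>s = 1/2\<close>.  By Taylor's theorem (\<open>stencil_bound\<close>) vanishing moments turn into powers of \<open>h\<close>.

  In two dimensions \<open>F = F\<^sub>x F\<^sub>y\<close> and \<open>B F = (1 + X) (1 + Y)\<close>, where \<open>X\<close> and \<open>Y\<close> are the
  one-dimensional operators \<open>s (1 - s) \<delta>\<^sup>2\<close> in the two directions, each with its own \<open>s\<close>.  Put
  \<open>P\<^sub>x = F\<^sub>x X\<close> and \<open>P\<^sub>y = F\<^sub>y Y\<close>.  The identity
    \<open>1 - (X + Y + X Y) / 2 = (1 - X / 2) (1 - Y / 2) - 3/4 X Y\<close>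
  gives for BFECC the operator
    \<open>(1 + E\<^sub>x) (1 + E\<^sub>y) - 3/4 P\<^sub>x P\<^sub>y\<close>  (\<open>bfecc2_eq\<close>).
  So the error consists of the two one-dimensional errors \<open>E\<^sub>x f\<close> and \<open>E\<^sub>y f\<close> and of two mixed terms,
  \<open>E\<^sub>x E\<^sub>y f\<close> and \<open>P\<^sub>x P\<^sub>y f\<close>.  In the mixed terms the moments of order 0 and 1 vanish in each
  direction, so they are \<open>O(h\<^sup>2 k\<^sup>2)\<close> (\<open>cross_bound\<close>), which is \<open>O(h\<^sup>4 + k\<^sup>4)\<close>.
\<close>

section \<open>Stencils\<close>

text \<open>
  A finite-difference functional is given by its list of pairs (weight, node), the nodes being
  measured in units of the mesh size relative to the point of evaluation.
\<close>
definition stencil :: "(real \<times> real) list \<Rightarrow> real \<Rightarrow> (real \<Rightarrow> real) \<Rightarrow> real \<Rightarrow> real" where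
  "stencil S h g x = (\<Sum>(c, a)\<leftarrow>S. c * g (x + a * h))"

definition moment :: "(real \<times> real) list \<Rightarrow> nat \<Rightarrow> real" where
  "moment S k = (\<Sum>(c, a)\<leftarrow>S. c * a ^ k)"

definition abs_moment :: "(real \<times> real) list \<Rightarrow> nat \<Rightarrow> real" where
  "abs_moment S k = (\<Sum>(c, a)\<leftarrow>S. \<bar>c\<bar> * \<bar>a\<bar> ^ k)"

lemma stencil_simps [simp]:
  "stencil [] h g x = 0"
  "stencil ((c, a) # S) h g x = c * g (x + a * h) + stencil S h g x"
  by (simp_all add: stencil_def)

lemma moment_simps [simp]:
  "moment [] k = 0" "moment ((c, a) # S) k = c * a ^ k + moment S k"
  by (simp_all add: moment_def)

lemma abs_moment_simps [simp]:
  "abs_moment [] k = 0" "abs_moment ((c, a) # S) k = \<bar>c\<bar> * \<bar>a\<bar> ^ k + abs_moment S k"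
  by (simp_all add: abs_moment_def)

lemma stencil_add: "stencil S h (\<lambda>t. u t + v t) x = stencil S h u x + stencil S h v x"
  by (induction S) (auto simp: algebra_simps)

lemma stencil_scale: "stencil S h (\<lambda>t. r * u t) x = r * stencil S h u x"
  by (induction S) (auto simp: algebra_simps)

text \<open>
  A stencil acting in one variable commutes with differentiation in the other, which allows
  two-dimensional stencils to be estimated one direction at a time.
\<close>

lemma stencil_has_derivative:
  assumes "\<And>y. ((\<lambda>x. u x y) has_real_derivative u' y) (at x)"
  shows "((\<lambda>x. stencil S k (u x) y) has_real_derivative stencil S k u' y) (at x)"
proof (induction S)
  case (Cons p S)
  then show ?case
    by (cases p) (auto intro!: DERIV_add DERIV_cmult assms)
qed simp

lemma abs_moment_le:
  assumes "\<And>c a. (c, a) \<in> set S \<Longrightarrow> \<bar>c\<bar> \<le> A \<and> \<bar>a\<bar> \<le> R" and "0 \<le> R"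
  shows "abs_moment S k \<le> real (length S) * (A * R ^ k)"
  using assms(1)
proof (induction S)
  case (Cons p S)
  obtain c a where p: "p = (c, a)" by (cases p)
  have ca: "\<bar>c\<bar> \<le> A" "\<bar>a\<bar> \<le> R" using Cons.prems[of c a] p by auto
  have "abs_moment S k \<le> real (length S) * (A * R ^ k)"
    using Cons.prems by (intro Cons.IH) auto
  moreover have "\<bar>c\<bar> * \<bar>a\<bar> ^ k \<le> A * R ^ k"
    using ca \<open>0 \<le> R\<close> by (intro mult_mono power_mono) auto
  ultimately show ?case by (simp add: p algebra_simps)
qed simp

text \<open>
  Taylor's theorem at the centre \<open>x\<close>: the \<open>k\<close>-th Taylor term contributes the \<open>k\<close>-th moment of the
  stencil, so when the moments below \<open>n\<close> vanish only the remainders survive.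
\<close>

lemma stencil_bound:
  assumes D0: "D 0 = g"
    and D: "\<And>m t. (D m has_real_derivative D (Suc m) t) (at t)"
    and M: "\<And>t. \<bar>D n t\<bar> \<le> M"
    and mom: "\<And>k. k < n \<Longrightarrow> moment S k = 0"
    and "0 \<le> h"
  shows "\<bar>stencil S h g x\<bar> \<le> abs_moment S n * h ^ n * M / fact n"
proof -
  define T where "T t = (\<Sum>m<n. D m x / fact m * t ^ m)" for t
  have rem: "\<bar>g (x + t) - T t\<bar> \<le> M / fact n * \<bar>t\<bar> ^ n" for t
  proof -
    have "\<exists>\<theta>. \<bar>\<theta>\<bar> \<le> \<bar>t\<bar> \<and> g (x + t) = (\<Sum>m<n. D m (x + 0) / fact m * t ^ m) + D n (x + \<theta>) / fact n * t ^ n"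
    proof (rule Maclaurin_all_le[where diff = "\<lambda>m u. D m (x + u)" and f = "\<lambda>u. g (x + u)"])
      show "\<forall>m u. DERIV (\<lambda>u. D m (x + u)) u :> D (Suc m) (x + u)"
        using D DERIV_shift[of "D m" "D (Suc m) (u + x)" u x for m u] by (simp add: add.commute)
    qed (simp add: D0)
    then obtain \<theta> where "g (x + t) = T t + D n (x + \<theta>) / fact n * t ^ n"
      by (auto simp: T_def)
    then have "\<bar>g (x + t) - T t\<bar> = \<bar>D n (x + \<theta>)\<bar> / fact n * \<bar>t\<bar> ^ n"
      by (simp add: abs_mult power_abs)
    also have "\<dots> \<le> M / fact n * \<bar>t\<bar> ^ n"
      using M by (intro mult_right_mono divide_right_mono) auto
    finally show ?thesis .
  qed
  \<comment> \<open>Stated for an arbitrary stencil, since the moments of its tail need not vanish in the induction.\<close>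
  have split: "stencil S' h g x = (\<Sum>m<n. D m x / fact m * h ^ m * moment S' m)
      + (\<Sum>(c, a)\<leftarrow>S'. c * (g (x + a * h) - T (a * h)))" for S'
    by (induction S')
       (auto simp: T_def sum.distrib sum_distrib_left algebra_simps power_mult_distrib
         add_divide_distrib)
  have "\<bar>\<Sum>(c, a)\<leftarrow>S'. c * (g (x + a * h) - T (a * h))\<bar> \<le> abs_moment S' n * h ^ n * M / fact n" for S'
  proof (induction S')
    case (Cons p S')
    obtain c a where p: "p = (c, a)" by (cases p)
    have "\<bar>c * (g (x + a * h) - T (a * h))\<bar> \<le> \<bar>c\<bar> * (M / fact n * \<bar>a * h\<bar> ^ n)"
      unfolding abs_mult[of c] by (intro mult_left_mono rem) auto
    also have "\<dots> = \<bar>c\<bar> * \<bar>a\<bar> ^ n * h ^ n * M / fact n"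
      using \<open>0 \<le> h\<close> by (simp add: abs_mult power_mult_distrib)
    finally show ?case using Cons by (simp add: p add_divide_distrib algebra_simps)
  qed simp
  moreover have "(\<Sum>m<n. D m x / fact m * h ^ m * moment S m) = 0"
    using mom by simp
  ultimately show ?thesis by (simp add: split)
qed


section \<open>Interpolation between shifted grids as a translation-invariant operator\<close>

definition two_point :: "real \<Rightarrow> real \<Rightarrow> (real \<Rightarrow> real) \<Rightarrow> real \<Rightarrow> real" where
  "two_point s h v x = (1 - s) * v (x - s * h) + s * v (x + (1 - s) * h)"

definition diff2 :: "real \<Rightarrow> (real \<Rightarrow> real) \<Rightarrow> real \<Rightarrow> real" where
  "diff2 h v x = v (x + h) - 2 * v x + v (x - h)"

lemma two_point_linear:
  "two_point s h (\<lambda>x. u x + v x) x0 = two_point s h u x0 + two_point s h v x0"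
  "two_point s h (\<lambda>x. u x - v x) x0 = two_point s h u x0 - two_point s h v x0"
  "two_point s h (\<lambda>x. r * u x) x0 = r * two_point s h u x0"
  by (simp_all add: two_point_def algebra_simps)

text \<open>
  The position of a shifted point inside its cell is the same for all points of the shifted grid;
  this is what makes the interpolation translation invariant.
\<close>

lemma lin_interp_forward:
  assumes "0 < h" "p \<in> grid1 w h"
  shows "lin_interp 0 h v p = two_point (frac (w / h)) h v p"
proof -
  obtain i :: int where p: "p = w + of_int i * h" using assms(2) by (auto simp: grid1_def)
  have fl: "\<lfloor>(p - 0) / h\<rfloor> = i + \<lfloor>w / h\<rfloor>"
    using \<open>0 < h\<close> by (simp add: p add_divide_distrib)
  have x0: "0 + of_int (i + \<lfloor>w / h\<rfloor>) * h = p - frac (w / h) * h"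
   and x1: "0 + of_int (i + \<lfloor>w / h\<rfloor> + 1) * h = p + (1 - frac (w / h)) * h"
   and s: "(p - (p - frac (w / h) * h)) / h = frac (w / h)"
    using \<open>0 < h\<close> by (simp_all add: p frac_def field_simps)
  show ?thesis
    unfolding lin_interp_def fl lin_cell_def two_point_def Let_def x0 x1 s ..
qed

text \<open>
  A point \<open>q\<close> of the first grid lies between the shifted points \<open>q - (1 - s) h\<close> and \<open>q + s h\<close>; seen
  from \<open>q\<close> this is the forward configuration reflected, hence the step \<open>- h\<close>.
\<close>

lemma lin_interp_backward:
  assumes "0 < h" "q \<in> grid1 0 h"
  shows "lin_interp w h v q = two_point (frac (w / h)) (- h) v q"
proof -
  obtain i :: int where q: "q = of_int i * h" using assms(2) by (auto simp: grid1_def)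
  define j where "j = i - \<lfloor>w / h\<rfloor> - 1"
  define s where "s = frac (w / h)"
  have s01: "0 \<le> s" "s \<le> 1" using frac_lt_1[of "w / h"] by (auto simp: s_def)
  have x0: "w + of_int j * h = q + (1 - s) * (- h)"
   and x1: "w + of_int (j + 1) * h = q - s * (- h)"
   and f: "(q - (q + (1 - s) * (- h))) / h = 1 - s"
    using \<open>0 < h\<close> by (simp_all add: q j_def s_def frac_def field_simps)
  have "0 \<le> s * h" "s * h \<le> h" using s01 \<open>0 < h\<close> by (auto simp: mult_le_cancel_right1)
  then have "q \<in> {w + of_int j * h .. w + of_int (j + 1) * h}"
    unfolding x0 x1 by (simp add: algebra_simps)
  \<comment> \<open>For \<open>s = 0\<close> the point lies in two cells, and this one is not the cell that the floor selects.\<close>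
  from lin_interp_eq_cell[OF \<open>0 < h\<close> this]
  have "lin_interp w h v q = lin_cell w h j v q" .
  also have "\<dots> = two_point s (- h) v q"
    unfolding lin_cell_def two_point_def Let_def x0 x1 f by simp
  finally show ?thesis by (simp add: s_def)
qed

lemma two_point_swap:
  "two_point s h (\<lambda>x. two_point t k (g x) y0) x0
   = two_point t k (\<lambda>y. two_point s h (\<lambda>x. g x y) x0) y0"
  by (simp add: two_point_def algebra_simps)

lemma two_point_diff2_swap:
  "two_point t k (\<lambda>y. diff2 h (\<lambda>x. g x y) x0) y0 = diff2 h (\<lambda>x. two_point t k (g x) y0) x0"
  by (simp add: two_point_def diff2_def algebra_simps)

text \<open>
  The operator product is \<open>((1 - s) T\<^sup>s + s T\<^sup>s\<^sup>-\<^sup>1) ((1 - s) T\<^sup>-\<^sup>s + s T\<^sup>1\<^sup>-\<^sup>s)\<close>, \<open>T\<close> being translation by \<open>h\<close>.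
  Its weights at \<open>T\<close> and \<open>T\<^sup>-\<^sup>1\<close> are both \<open>s (1 - s)\<close>, and all its weights add up to 1.
\<close>

lemma two_point_back_forth:
  "two_point s (- h) (two_point s h v) x = v x + s * (1 - s) * diff2 h v x"
proof -
  have pts: "x - s * (- h) - s * h = x" "x - s * (- h) + (1 - s) * h = x + h"
    "x + (1 - s) * (- h) - s * h = x - h" "x + (1 - s) * (- h) + (1 - s) * h = x"
    by (simp_all add: algebra_simps)
  show ?thesis
    unfolding two_point_def diff2_def pts by (simp add: algebra_simps)
qed


section \<open>The defect and curvature stencils\<close>

text \<open>
  The stencil of the one-dimensional BFECC error \<open>F (1 - s (1 - s) \<delta>\<^sup>2 / 2) - 1\<close>: the first four nodes
  are the four grid points around \<open>p\<close>, the last entry subtracts the exact value at \<open>p\<close>.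
\<close>
definition defect :: "real \<Rightarrow> (real \<times> real) list" where
  "defect s =
    [(- (s * (1 - s) * (1 - s) / 2), - s - 1),
     ((1 - s) * (1 + s * (1 - s)) - s * (1 - s) * s / 2, - s),
     (s * (1 + s * (1 - s)) - s * (1 - s) * (1 - s) / 2, 1 - s),
     (- (s * (1 - s) * s / 2), 2 - s),
     (- 1, 0)]"

text \<open>
  The stencil of \<open>s (1 - s) F \<delta>\<^sup>2\<close>, whose leading term is \<open>s (1 - s) h\<^sup>2\<close> times the second derivative.
\<close>
definition curvature :: "real \<Rightarrow> (real \<times> real) list" where
  "curvature s =
    [(s * (1 - s) * (1 - s), - s - 1),
     (s * (1 - s) * (s - 2 * (1 - s)), - s),
     (s * (1 - s) * ((1 - s) - 2 * s), 1 - s),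
     (s * (1 - s) * s, 2 - s)]"

lemma two_point_diff2:
  "two_point s h (\<lambda>q. s * (1 - s) * diff2 h v q) x = stencil (curvature s) h v x"
proof -
  have pts: "x - s * h + h = x + (1 - s) * h" "x - s * h - h = x + (- s - 1) * h"
    "x + (1 - s) * h + h = x + (2 - s) * h" "x + (1 - s) * h - h = x + (- s) * h"
    "x - s * h = x + (- s) * h"
    by (simp_all add: algebra_simps)
  show ?thesis
    unfolding two_point_def diff2_def curvature_def stencil_simps pts
    by (simp add: algebra_simps)
qed

text \<open>
  This is the definition of the defect solved for \<open>F\<close>.  Eliminating \<open>F\<close> in this way leaves only
  stencils with vanishing low moments.
\<close>

lemma two_point_decompose:
  "two_point s h v x = v x + stencil (defect s) h v x + stencil (curvature s) h v x / 2"
proof -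
  have "x - s * h = x + (- s) * h" "x + 0 * h = x"
    by (simp_all add: algebra_simps)
  then show ?thesis
    unfolding two_point_def defect_def curvature_def stencil_simps
    by (simp add: field_simps)
qed

lemma defect_moment: "k < 3 \<Longrightarrow> moment (defect s) k = 0"
  by (auto simp: defect_def less_Suc_eq numeral_eq_Suc field_simps)

lemma defect_moment_centroid: "k < 4 \<Longrightarrow> moment (defect (1 / 2)) k = 0"
  by (auto simp: defect_def less_Suc_eq numeral_eq_Suc field_simps)

lemma curvature_moment: "k < 2 \<Longrightarrow> moment (curvature s) k = 0"
  by (auto simp: curvature_def less_Suc_eq numeral_eq_Suc field_simps)

text \<open>
  All weights and nodes are at most 2 in absolute value, whatever the shift, and there are at most
  five of them.  This uniformity in \<open>s\<close> is why the final constant does not depend on the shift.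
\<close>

lemma abs_moment_defect_curvature:
  assumes "0 \<le> s" "s \<le> 1"
  shows "abs_moment (defect s) k \<le> 10 * 2 ^ k" "abs_moment (curvature s) k \<le> 10 * 2 ^ k"
proof -
  define c where "c = s * (1 - s)"
  have c: "0 \<le> c" "c \<le> 1" using assms by (auto simp: c_def mult_le_one)
  have cs: "0 \<le> c * s" "c * s \<le> c" "0 \<le> c * (1 - s)" "c * (1 - s) \<le> c"
    using assms c by (auto intro: mult_left_le)
  have D: "\<bar>c'\<bar> \<le> 2 \<and> \<bar>a\<bar> \<le> 2" if "(c', a) \<in> set (defect s)" for c' a
  proof -
    define A B where "A = (1 - s) * (1 + c)" and "B = s * (1 + c)"
    have "0 \<le> A \<and> A \<le> 2" "0 \<le> B \<and> B \<le> 2"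
      unfolding A_def B_def using assms c mult_mono[of "1 - s" 1 "1 + c" 2] mult_mono[of s 1 "1 + c" 2] by auto
    then have "\<bar>A - c * s / 2\<bar> \<le> 2" "\<bar>B - c * (1 - s) / 2\<bar> \<le> 2"
      using c cs by linarith+
    with that assms c cs show ?thesis
      by (auto simp: defect_def simp flip: c_def A_def B_def)
  qed
  have P: "\<bar>c'\<bar> \<le> 2 \<and> \<bar>a\<bar> \<le> 2" if "(c', a) \<in> set (curvature s)" for c' a
  proof -
    have "\<bar>c * (s - 2 * (1 - s))\<bar> \<le> 1 * 2" "\<bar>c * ((1 - s) - 2 * s)\<bar> \<le> 1 * 2"
      using assms c unfolding abs_mult by (intro mult_mono; auto)+
    with that assms c cs show ?thesis by (auto simp: curvature_def simp flip: c_def)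
  qed
  show "abs_moment (defect s) k \<le> 10 * 2 ^ k"
    using abs_moment_le[of "defect s" 2 2 k] D by (simp add: defect_def)
  have "abs_moment (curvature s) k \<le> 8 * 2 ^ k"
    using abs_moment_le[of "curvature s" 2 2 k] P by (simp add: curvature_def)
  also have "\<dots> \<le> 10 * 2 ^ k" by simp
  finally show "abs_moment (curvature s) k \<le> 10 * 2 ^ k" .
qed

section \<open>BFECC in terms of the stencils\<close>

lemma bfecc1_eq:
  assumes "0 < h" "p \<in> grid1 w h"
  shows "bfecc1 h w f p = f p + stencil (defect (frac (w / h))) h f p"
proof -
  define s where "s = frac (w / h)"
  have roundtrip: "lin_interp w h (lin_interp 0 h f) q = f q + s * (1 - s) * diff2 h f q"
    if "q \<in> grid1 0 h" for q
  proof -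
    have "lin_interp w h (lin_interp 0 h f) q = lin_interp w h (two_point s h f) q"
      using \<open>0 < h\<close> by (intro lin_interp_cong) (simp add: lin_interp_forward s_def)
    then show ?thesis
      using \<open>0 < h\<close> that
      by (simp add: lin_interp_backward two_point_back_forth flip: s_def)
  qed
  have "bfecc1 h w f p = lin_interp 0 h (\<lambda>q. f q - 1/2 * (s * (1 - s) * diff2 h f q)) p"
    unfolding bfecc1_def bfecc_def Let_def by (rule lin_interp_cong) (simp add: roundtrip)
  also have "\<dots> = two_point s h (\<lambda>q. f q - 1/2 * (s * (1 - s) * diff2 h f q)) p"
    using assms by (simp add: lin_interp_forward s_def)
  also have "\<dots> = two_point s h f p - 1/2 * two_point s h (\<lambda>q. s * (1 - s) * diff2 h f q) p"
    unfolding two_point_linear ..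
  also have "\<dots> = f p + stencil (defect s) h f p"
    unfolding two_point_diff2 by (simp add: two_point_decompose)
  finally show ?thesis by (simp add: s_def)
qed

lemma bilin_interp_forward:
  assumes "0 < h" "0 < k" "p \<in> grid2 (w1, w2) (h, k)"
  shows "bilin_interp (0, 0) (h, k) v p
    = two_point (frac (w1 / h)) h (\<lambda>x. two_point (frac (w2 / k)) k (\<lambda>y. v (x, y)) (snd p)) (fst p)"
  using assms bilin_interp_eq_lin_interp[of "(0, 0)" "(h, k)" v "fst p" "snd p"]
  by (simp add: grid2_def mem_Times_iff lin_interp_forward[where w = w1]
      lin_interp_forward[where w = w2])

lemma bilin_interp_backward:
  assumes "0 < h" "0 < k" "q \<in> grid2 (0, 0) (h, k)"
  shows "bilin_interp (w1, w2) (h, k) v q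
    = two_point (frac (w1 / h)) (- h)
        (\<lambda>x. two_point (frac (w2 / k)) (- k) (\<lambda>y. v (x, y)) (snd q)) (fst q)"
  using assms bilin_interp_eq_lin_interp[of "(w1, w2)" "(h, k)" v "fst q" "snd q"]
  by (simp add: grid2_def mem_Times_iff lin_interp_backward)

text \<open>
  Write \<open>\<Phi> = F\<^sub>y f = f + E\<^sub>y f + P\<^sub>y f / 2\<close>.  Applying \<open>F\<^sub>y\<close> to the compensated values yields
  \<open>\<Phi> - (X \<Phi> + P\<^sub>y f + X P\<^sub>y f) / 2\<close>.  Then \<open>F\<^sub>x\<close> is applied, with \<open>F\<^sub>x X = P\<^sub>x\<close> and
  \<open>F\<^sub>x = 1 + E\<^sub>x + P\<^sub>x / 2\<close>: the terms \<open>P\<^sub>x \<Phi> / 2\<close> cancel, and \<open>P\<^sub>x P\<^sub>y f\<close> is left with the coefficient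
  \<open>- 1/4 - 1/2\<close>.
\<close>

lemma bfecc2_eq:
  assumes "0 < h" "0 < k" "(x, y) \<in> grid2 (w1, w2) (h, k)"
  defines "s \<equiv> frac (w1 / h)" and "t \<equiv> frac (w2 / k)"
  shows "bfecc2 (h, k) (w1, w2) f (x, y) = f (x, y)
    + stencil (defect s) h (\<lambda>x'. f (x', y)) x
    + stencil (defect t) k (\<lambda>y'. f (x, y')) y
    + stencil (defect s) h (\<lambda>x'. stencil (defect t) k (\<lambda>y'. f (x', y')) y) x
    - 3/4 * stencil (curvature s) h (\<lambda>x'. stencil (curvature t) k (\<lambda>y'. f (x', y')) y) x"
proof -
  define F where "F x' y' = two_point s h (\<lambda>x. two_point t k (\<lambda>y. f (x, y)) y') x'" for x' y'
  define X where "X g x' = s * (1 - s) * diff2 h g x'" for g x'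
  define Y where "Y g y' = t * (1 - t) * diff2 k g y'" for g y'
  define G where "G x' = (\<lambda>y'. f (x', y')
    - 1/2 * (X (\<lambda>x. f (x, y')) x' + Y (\<lambda>y. f (x', y)) y' + X (\<lambda>x. Y (\<lambda>y. f (x, y)) y') x'))"
    for x'
  have roundtrip: "bilin_interp (w1, w2) (h, k) (bilin_interp (0, 0) (h, k) f) (x', y')
      = f (x', y') + X (\<lambda>x. f (x, y')) x' + Y (\<lambda>y. f (x', y)) y' + X (\<lambda>x. Y (\<lambda>y. f (x, y)) y') x'"
    (is "?L = ?R") if q: "(x', y') \<in> grid2 (0, 0) (h, k)" for x' y'
  proof -
    have "?L = bilin_interp (w1, w2) (h, k) (\<lambda>p. F (fst p) (snd p)) (x', y')"
      using assms(1,2)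
      by (intro bilin_interp_cong) (simp add: bilin_interp_forward F_def s_def t_def)
    also have "\<dots> = two_point s (- h) (\<lambda>x. two_point t (- k) (F x) y') x'"
      using assms(1,2) q by (simp add: bilin_interp_backward s_def t_def)
    also have "\<dots> = two_point s (- h) (two_point s h
        (\<lambda>x. two_point t (- k) (two_point t k (\<lambda>y. f (x, y))) y')) x'"
      \<comment> \<open>\<open>B\<^sub>y\<close> commutes with \<open>F\<^sub>x\<close>, so that both round trips become one-dimensional.\<close>
      unfolding F_def by (subst two_point_swap) (rule refl)
    also have "\<dots> = ?R"
      unfolding two_point_back_forth X_def Y_def
      by (simp add: diff2_def algebra_simps)
    finally show ?thesis .
  qed
  define e where "e = (\<lambda>x'. stencil (defect t) k (\<lambda>y'. f (x', y')) y)"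
  define q where "q = (\<lambda>x'. stencil (curvature t) k (\<lambda>y'. f (x', y')) y)"
  define \<Phi> where "\<Phi> x' = two_point t k (\<lambda>y'. f (x', y')) y" for x'
  have \<Phi>: "\<Phi> x' = f (x', y) + e x' + 1/2 * q x'" for x'
    by (simp add: \<Phi>_def e_def q_def two_point_decompose)
  have inner: "two_point t k (G x') y = \<Phi> x' - 1/2 * (X \<Phi> x' + q x' + X q x')" for x'
  proof -
    have "two_point t k (G x') y = \<Phi> x' - 1/2 * (X \<Phi> x'
        + two_point t k (Y (\<lambda>y. f (x', y))) y
        + X (\<lambda>x. two_point t k (Y (\<lambda>y. f (x, y))) y) x')"
      unfolding G_def \<Phi>_def X_def two_point_linear two_point_diff2_swap by simp
    moreover have "two_point t k (Y (\<lambda>y. f (x, y))) y = q x" for x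
      unfolding Y_def q_def by (rule two_point_diff2)
    ultimately show ?thesis by simp
  qed
  have "bfecc2 (h, k) (w1, w2) f (x, y) = bilin_interp (0, 0) (h, k) (\<lambda>p. G (fst p) (snd p)) (x, y)"
    unfolding bfecc2_def bfecc_def Let_def
    by (rule bilin_interp_cong) (auto simp: roundtrip G_def field_simps)
  also have "\<dots> = two_point s h (\<lambda>x'. two_point t k (G x') y) x"
    using assms by (simp add: bilin_interp_forward)
  also have "\<dots> = two_point s h \<Phi> x - 1/2 * two_point s h (X \<Phi>) x
      - 1/2 * two_point s h q x - 1/2 * two_point s h (X q) x"
    unfolding inner two_point_linear by (simp add: algebra_simps)
  also have "\<dots> = \<Phi> x + stencil (defect s) h \<Phi> x - 1/2 * (q x + stencil (defect s) h q x)
      - 3/4 * stencil (curvature s) h q x"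
    unfolding X_def two_point_diff2 unfolding two_point_decompose
    by (simp add: add_divide_distrib)
  also have "\<dots> = f (x, y) + e x + stencil (defect s) h (\<lambda>x'. f (x', y)) x
      + stencil (defect s) h e x - 3/4 * stencil (curvature s) h q x"
    unfolding \<Phi> stencil_add stencil_scale by (simp add: add_divide_distrib)
  finally show ?thesis by (simp add: e_def q_def)
qed


section \<open>Iterated derivatives of smooth functions\<close>

lemma smooth1_derivs:
  assumes "smooth1 f"
  shows "((deriv ^^ m) f has_real_derivative (deriv ^^ Suc m) f t) (at t)"
  using assms by (simp add: smooth1_def field_differentiable_derivI)

lemma smooth1_bounded:
  assumes "smooth1 f"
  obtains M where "\<And>t. \<bar>(deriv ^^ Suc n) f t\<bar> \<le> M"
proof -
  have "bounded (range ((deriv ^^ Suc n) f))"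
    using assms unfolding smooth1_def by (metis le_add1 plus_1_eq_Suc)
  then show ?thesis using that by (auto simp: bounded_iff)
qed

lemma partials_trans: "u \<in> partials g \<Longrightarrow> g \<in> partials f \<Longrightarrow> u \<in> partials f"
  by (induction rule: partials.induct) (auto intro: partials.intros)

lemma smooth2_partials: "smooth2 f \<Longrightarrow> g \<in> partials f \<Longrightarrow> smooth2 g"
  unfolding smooth2_def by (blast intro: partials_trans)

lemma iterate_partial_in_partials:
  "(partial_x ^^ m) f \<in> partials f" "(partial_y ^^ m) f \<in> partials f"
  by (induction m) (auto intro: partials.intros)

lemma smooth2_derivs:
  assumes "smooth2 f"
  shows "((\<lambda>x. (partial_x ^^ m) f (x, y)) has_real_derivative (partial_x ^^ Suc m) f (x, y)) (at x)"
    and "((\<lambda>y. (partial_y ^^ m) f (x, y)) has_real_derivative (partial_y ^^ Suc m) f (x, y)) (at y)"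
  using assms iterate_partial_in_partials[of m f]
  by (auto simp: smooth2_def partial_x_def partial_y_def intro!: field_differentiable_derivI)

lemma smooth2_bounded:
  assumes "smooth2 f"
  obtains M where "\<And>p. \<bar>(partial_x ^^ Suc n) f p\<bar> \<le> M" "\<And>p. \<bar>(partial_y ^^ Suc n) f p\<bar> \<le> M"
proof -
  have "bounded (range ((partial_x ^^ Suc n) f))" "bounded (range ((partial_y ^^ Suc n) f))"
    using assms iterate_partial_in_partials[of n f] by (auto simp: smooth2_def)
  then obtain A B where "\<forall>p. \<bar>(partial_x ^^ Suc n) f p\<bar> \<le> A" "\<forall>p. \<bar>(partial_y ^^ Suc n) f p\<bar> \<le> B"
    by (auto simp: bounded_iff)
  then show ?thesis by (intro that[of "max A B"]) (auto simp: le_max_iff_disj)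
qed


section \<open>Error bounds\<close>

text \<open>
  For \<open>n \<le> 4\<close> the single constant \<open>160 = 10 * 2 ^ 4\<close> covers both stencils at all the orders of
  accuracy that occur, so the third- and fourth-order estimates can share one constant.
\<close>

lemma stencil_bound_crude:
  assumes "D 0 = g"
    and "\<And>m t. (D m has_real_derivative D (Suc m) t) (at t)"
    and M: "\<And>t. \<bar>D n t\<bar> \<le> M"
    and "\<And>k. k < n \<Longrightarrow> moment S k = 0"
    and "0 \<le> h" and A: "abs_moment S n \<le> 10 * 2 ^ n" and n: "n \<le> 4"
  shows "\<bar>stencil S h g x\<bar> \<le> 160 * M * h ^ n"
proof -
  have "0 \<le> M" using M[of 0] by linarith
  have "(2::real) ^ n \<le> 2 ^ 4" using n by (intro power_increasing) auto
  then have A': "abs_moment S n \<le> 160" using A by simp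
  have "\<bar>stencil S h g x\<bar> \<le> abs_moment S n * h ^ n * M / fact n"
    by (rule stencil_bound[of D]) (use assms in auto)
  also have "\<dots> \<le> 160 * h ^ n * M / 1"
    using A' \<open>0 \<le> M\<close> \<open>0 \<le> h\<close> fact_ge_1[of n]
    by (intro frac_le mult_right_mono mult_nonneg_nonneg) auto
  finally show ?thesis by (simp add: mult_ac)
qed

lemma defect_bounds:
  fixes h w :: real
  assumes D: "D 0 = g" "\<And>m t. (D m has_real_derivative D (Suc m) t) (at t)"
    and M: "\<And>t. \<bar>D 3 t\<bar> \<le> M" "\<And>t. \<bar>D 4 t\<bar> \<le> M"
    and "0 < h"
  defines "s \<equiv> frac (w / h)"
  shows "\<bar>stencil (defect s) h g x\<bar> \<le> 160 * M * h ^ 3"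
    and "w / h - 1/2 \<in> \<int> \<Longrightarrow> \<bar>stencil (defect s) h g x\<bar> \<le> 160 * M * h ^ 4"
proof -
  have s: "0 \<le> s" "s \<le> 1" using frac_lt_1[of "w / h"] by (auto simp: s_def)
  show "\<bar>stencil (defect s) h g x\<bar> \<le> 160 * M * h ^ 3"
    by (rule stencil_bound_crude[of D])
       (use assms defect_moment abs_moment_defect_curvature[OF s, of 3] in auto)
  assume "w / h - 1/2 \<in> \<int>"
  then have half: "s = 1/2"
    unfolding s_def by (subst frac_unique_iff) auto
  show "\<bar>stencil (defect s) h g x\<bar> \<le> 160 * M * h ^ 4"
    by (rule stencil_bound_crude[of D])
       (use assms half defect_moment_centroid abs_moment_defect_curvature[OF s, of 4] in auto)
qed

text \<open>
  The inner stencil is regarded as a function of \<open>x\<close>; its second derivative is the same stencil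
  applied to the second \<open>x\<close>-derivative of \<open>f\<close>, hence \<open>O(k\<^sup>2)\<close>, and the outer stencil contributes the
  factor \<open>h\<^sup>2\<close>.  Taking the partial derivatives in this order avoids exchanging them.
\<close>

lemma cross_bound:
  assumes f: "smooth2 f"
    and M: "\<And>p. \<bar>(partial_y ^^ 2) ((partial_x ^^ 2) f) p\<bar> \<le> M"
    and S: "\<And>j. j < 2 \<Longrightarrow> moment S j = 0" "abs_moment S 2 \<le> 10 * 2 ^ 2"
    and T: "\<And>j. j < 2 \<Longrightarrow> moment T j = 0" "abs_moment T 2 \<le> 10 * 2 ^ 2"
    and "0 \<le> h" "0 \<le> k"
  shows "\<bar>stencil S h (\<lambda>x. stencil T k (\<lambda>y. f (x, y)) y0) x0\<bar> \<le> 25600 * M * (h\<^sup>2 * k\<^sup>2)"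
proof -
  have g: "smooth2 ((partial_x ^^ 2) f)"
    using f iterate_partial_in_partials(1) by (rule smooth2_partials)
  have inner: "\<bar>stencil T k (\<lambda>y. (partial_x ^^ 2) f (x, y)) y0\<bar> \<le> 160 * M * k\<^sup>2" for x
    by (rule stencil_bound_crude[of "\<lambda>m y. (partial_y ^^ m) ((partial_x ^^ 2) f) (x, y)"])
       (use smooth2_derivs(2)[OF g] M T \<open>0 \<le> k\<close> in auto)
  have "\<bar>stencil S h (\<lambda>x. stencil T k (\<lambda>y. f (x, y)) y0) x0\<bar> \<le> 160 * (160 * M * k\<^sup>2) * h\<^sup>2"
  proof (rule stencil_bound_crude[of "\<lambda>m x. stencil T k (\<lambda>y. (partial_x ^^ m) f (x, y)) y0"])
    show "((\<lambda>x. stencil T k (\<lambda>y. (partial_x ^^ m) f (x, y)) y0) has_real_derivative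
        stencil T k (\<lambda>y. (partial_x ^^ Suc m) f (t, y)) y0) (at t)" for m t
      by (intro stencil_has_derivative smooth2_derivs(1)[OF f])
  qed (use inner S \<open>0 \<le> h\<close> in auto)
  then show ?thesis by (simp add: mult_ac)
qed

lemma square_product_le:
  fixes h k :: real
  assumes "0 < h" "h \<le> 1" "0 < k" "k \<le> 1"
  shows "h\<^sup>2 * k\<^sup>2 \<le> h ^ 4 + k ^ 4" "h\<^sup>2 * k\<^sup>2 \<le> h ^ 3 + k ^ 3"
proof -
  have "2 * (h\<^sup>2 * k\<^sup>2) \<le> h ^ 4 + k ^ 4"
    using zero_le_power2[of "h\<^sup>2 - k\<^sup>2"] by (simp add: power2_eq_square algebra_simps numeral_eq_Suc)
  moreover have "0 \<le> h\<^sup>2 * k\<^sup>2" by simp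
  ultimately show "h\<^sup>2 * k\<^sup>2 \<le> h ^ 4 + k ^ 4" by linarith
  also have "\<dots> \<le> h ^ 3 + k ^ 3"
    using assms by (intro add_mono power_decreasing) auto
  finally show "h\<^sup>2 * k\<^sup>2 \<le> h ^ 3 + k ^ 3" .
qed

theorem bfecc1_accuracy:
  assumes f: "smooth1 f"
  shows "\<exists>C. \<forall>h w. 0 < h \<and> h \<le> 1 \<longrightarrow>
    (\<forall>p\<in>grid1 w h. \<bar>bfecc1 h w f p - f p\<bar> \<le> C * h ^ 3) \<and>
    (w / h - 1/2 \<in> \<int> \<longrightarrow> (\<forall>p\<in>grid1 w h. \<bar>bfecc1 h w f p - f p\<bar> \<le> C * h ^ 4))"
proof -
  obtain M3 M4 where "\<And>t. \<bar>(deriv ^^ Suc 2) f t\<bar> \<le> M3" "\<And>t. \<bar>(deriv ^^ Suc 3) f t\<bar> \<le> M4"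
    using smooth1_bounded[OF f] by metis
  then have M: "\<bar>(deriv ^^ 3) f t\<bar> \<le> max M3 M4" "\<bar>(deriv ^^ 4) f t\<bar> \<le> max M3 M4" for t
    by (auto simp: numeral_eq_Suc le_max_iff_disj)
  note bounds = defect_bounds[where D = "\<lambda>m. (deriv ^^ m) f", OF _ smooth1_derivs[OF f] M]
  show ?thesis
    by (rule exI[of _ "160 * max M3 M4"]) (auto simp: bfecc1_eq intro!: bounds)
qed

theorem bfecc2_accuracy:
  assumes f: "smooth2 f"
  shows "\<exists>C. \<forall>h k w1 w2. 0 < h \<and> h \<le> 1 \<and> 0 < k \<and> k \<le> 1 \<longrightarrow>
    (\<forall>p\<in>grid2 (w1, w2) (h, k). \<bar>bfecc2 (h, k) (w1, w2) f p - f p\<bar> \<le> C * (h ^ 3 + k ^ 3)) \<and>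
    (w1 / h - 1/2 \<in> \<int> \<and> w2 / k - 1/2 \<in> \<int> \<longrightarrow>
      (\<forall>p\<in>grid2 (w1, w2) (h, k). \<bar>bfecc2 (h, k) (w1, w2) f p - f p\<bar> \<le> C * (h ^ 4 + k ^ 4)))"
proof -
  have g: "smooth2 ((partial_x ^^ 2) f)"
    using f iterate_partial_in_partials(1) by (rule smooth2_partials)
  obtain M3 where M3: "\<And>p. \<bar>(partial_x ^^ Suc 2) f p\<bar> \<le> M3" "\<And>p. \<bar>(partial_y ^^ Suc 2) f p\<bar> \<le> M3"
    using smooth2_bounded[OF f] by blast
  obtain M4 where M4: "\<And>p. \<bar>(partial_x ^^ Suc 3) f p\<bar> \<le> M4" "\<And>p. \<bar>(partial_y ^^ Suc 3) f p\<bar> \<le> M4"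
    using smooth2_bounded[OF f] by blast
  obtain N where N: "\<And>p. \<bar>(partial_y ^^ Suc 1) ((partial_x ^^ 2) f) p\<bar> \<le> N"
    using smooth2_bounded[OF g] by blast
  define M where "M = max M3 M4"
  have M: "\<bar>(partial_x ^^ 3) f p\<bar> \<le> M" "\<bar>(partial_x ^^ 4) f p\<bar> \<le> M"
      "\<bar>(partial_y ^^ 3) f p\<bar> \<le> M" "\<bar>(partial_y ^^ 4) f p\<bar> \<le> M" for p
    using M3[of p] M4[of p] by (auto simp: M_def numeral_eq_Suc le_max_iff_disj)
  have N': "\<bar>(partial_y ^^ 2) ((partial_x ^^ 2) f) p\<bar> \<le> N" for p
    using N[of p] by (simp add: numeral_eq_Suc)
  have "0 \<le> M" "0 \<le> N" using M(1)[of 0] N'[of 0] by linarith+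
  \<comment> \<open>\<open>M\<close> pays for the one-dimensional errors, \<open>N\<close> for the two mixed terms.\<close>
  define C where "C = 160 * M + 2 * 25600 * N"
  show ?thesis
  proof (intro exI[of _ C] allI impI, elim conjE)
    fix h k w1 w2 :: real
    assume hk: "0 < h" "h \<le> 1" "0 < k" "k \<le> 1"
    define s t where "s = frac (w1 / h)" and "t = frac (w2 / k)"
    have st: "0 \<le> s" "s \<le> 1" "0 \<le> t" "t \<le> 1"
      using frac_lt_1[of "w1 / h"] frac_lt_1[of "w2 / k"] by (auto simp: s_def t_def)
    define Ex where "Ex x y = stencil (defect s) h (\<lambda>x'. f (x', y)) x" for x y
    define Ey where "Ey x y = stencil (defect t) k (\<lambda>y'. f (x, y')) y" for x y
    have Ex: "\<bar>Ex x y\<bar> \<le> 160 * M * h ^ 3" "w1 / h - 1/2 \<in> \<int> \<Longrightarrow> \<bar>Ex x y\<bar> \<le> 160 * M * h ^ 4" for x y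
      unfolding Ex_def s_def
      using defect_bounds[where D = "\<lambda>m x. (partial_x ^^ m) f (x, y)" and g = "\<lambda>x. f (x, y)",
          OF _ smooth2_derivs(1)[OF f] M(1,2) hk(1)] by auto
    have Ey: "\<bar>Ey x y\<bar> \<le> 160 * M * k ^ 3" "w2 / k - 1/2 \<in> \<int> \<Longrightarrow> \<bar>Ey x y\<bar> \<le> 160 * M * k ^ 4" for x y
      unfolding Ey_def t_def
      using defect_bounds[where D = "\<lambda>m y. (partial_y ^^ m) f (x, y)" and g = "\<lambda>y. f (x, y)",
          OF _ smooth2_derivs(2)[OF f] M(3,4) hk(3)] by auto
    have err: "\<bar>bfecc2 (h, k) (w1, w2) f (x, y) - f (x, y)\<bar>
        \<le> \<bar>Ex x y\<bar> + \<bar>Ey x y\<bar> + 2 * 25600 * N * (h\<^sup>2 * k\<^sup>2)"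
      if "(x, y) \<in> grid2 (w1, w2) (h, k)" for x y
    proof -
      have "\<bar>stencil (defect s) h (\<lambda>x'. stencil (defect t) k (\<lambda>y'. f (x', y')) y) x\<bar>
          \<le> 25600 * N * (h\<^sup>2 * k\<^sup>2)"
        by (rule cross_bound[OF f N'])
           (use hk defect_moment abs_moment_defect_curvature[of _ 2] st in auto)
      moreover have "\<bar>stencil (curvature s) h (\<lambda>x'. stencil (curvature t) k (\<lambda>y'. f (x', y')) y) x\<bar>
          \<le> 25600 * N * (h\<^sup>2 * k\<^sup>2)"
        by (rule cross_bound[OF f N'])
           (use hk curvature_moment abs_moment_defect_curvature[of _ 2] st in auto)
      ultimately show ?thesis
        using bfecc2_eq[OF hk(1,3) that, of f] unfolding Ex_def Ey_def s_def t_def by linarith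
    qed
    have C: "160 * M * a + 160 * M * b + 2 * 25600 * N * (h\<^sup>2 * k\<^sup>2) \<le> C * (a + b)"
      if "h\<^sup>2 * k\<^sup>2 \<le> a + b" for a b
      using mult_left_mono[OF that, of "2 * 25600 * N"] \<open>0 \<le> N\<close> by (simp add: C_def algebra_simps)
    show "(\<forall>p\<in>grid2 (w1, w2) (h, k).
          \<bar>bfecc2 (h, k) (w1, w2) f p - f p\<bar> \<le> C * (h ^ 3 + k ^ 3)) \<and>
        (w1 / h - 1/2 \<in> \<int> \<and> w2 / k - 1/2 \<in> \<int> \<longrightarrow>
          (\<forall>p\<in>grid2 (w1, w2) (h, k).
            \<bar>bfecc2 (h, k) (w1, w2) f p - f p\<bar> \<le> C * (h ^ 4 + k ^ 4)))"
    proof (intro conjI ballI impI)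
      fix p assume p: "p \<in> grid2 (w1, w2) (h, k)"
      obtain x y where xy: "p = (x, y)" by (cases p)
      show "\<bar>bfecc2 (h, k) (w1, w2) f p - f p\<bar> \<le> C * (h ^ 3 + k ^ 3)"
        using err[of x y] p Ex(1)[of x y] Ey(1)[of x y] C[OF square_product_le(2)[OF hk]]
        unfolding xy by linarith
      assume half: "w1 / h - 1/2 \<in> \<int> \<and> w2 / k - 1/2 \<in> \<int>"
      show "\<bar>bfecc2 (h, k) (w1, w2) f p - f p\<bar> \<le> C * (h ^ 4 + k ^ 4)"
        using err[of x y] p Ex(2)[OF conjunct1[OF half], of x y] Ey(2)[OF conjunct2[OF half], of x y]
          C[OF square_product_le(1)[OF hk]]
        unfolding xy by linarith
    qed
  qed
qed

theorem theorem3: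
  "(\<forall>f :: real \<Rightarrow> real. smooth1 f \<longrightarrow>
      (\<exists>C::real. \<forall>\<Delta>x w :: real. 0 < \<Delta>x \<and> \<Delta>x \<le> 1 \<longrightarrow>
        (\<forall>p\<in>grid1 w \<Delta>x. \<bar>bfecc1 \<Delta>x w f p - f p\<bar> \<le> C * \<Delta>x ^ 3) \<and>
        (w / \<Delta>x - 1/2 \<in> \<int> \<longrightarrow>
          (\<forall>p\<in>grid1 w \<Delta>x. \<bar>bfecc1 \<Delta>x w f p - f p\<bar> \<le> C * \<Delta>x ^ 4)))) \<and>
   (\<forall>f :: real \<times> real \<Rightarrow> real. smooth2 f \<longrightarrow>
      (\<exists>C::real. \<forall>\<Delta>x \<Delta>y w1 w2 :: real. 0 < \<Delta>x \<and> \<Delta>x \<le> 1 \<and> 0 < \<Delta>y \<and> \<Delta>y \<le> 1 \<longrightarrow>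
        (\<forall>p\<in>grid2 (w1, w2) (\<Delta>x, \<Delta>y).
          \<bar>bfecc2 (\<Delta>x, \<Delta>y) (w1, w2) f p - f p\<bar> \<le> C * (\<Delta>x ^ 3 + \<Delta>y ^ 3)) \<and>
        (w1 / \<Delta>x - 1/2 \<in> \<int> \<and> w2 / \<Delta>y - 1/2 \<in> \<int> \<longrightarrow>
          (\<forall>p\<in>grid2 (w1, w2) (\<Delta>x, \<Delta>y).
            \<bar>bfecc2 (\<Delta>x, \<Delta>y) (w1, w2) f p - f p\<bar> \<le> C * (\<Delta>x ^ 4 + \<Delta>y ^ 4)))))"
  using bfecc1_accuracy bfecc2_accuracy by blast

end
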